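(* Let $t>r\geq 2$ be integers and let $n\geq r$ be an integer with $(r-1)^r$ dividing $n-r$. Then \[ {\rm spex}^{\rm lin}_r(n,\text{Berge-}K_{3,t})\geq 2^{-2/r}\Big(\sqrt{1+\tfrac{(n-r)2^{r+1}}{r-1}}+1\Big)^{2/r}. \]
   Context: An $r$-graph ($r$-uniform hypergraph) $H$ has edges that are $r$-element subsets of $V(H)$; it is linear if any two distinct edges share at most one vertex. For a simple graph $F$, $H$ is a Berge-$F$ if there is a bijection $\phi:E(F)\to E(H)$ with $e\subseteq\phi(e)$ for all $e\in E(F)$; $H$ is Berge-$F$-free if no sub-hypergraph (subset of its edges) is a Berge-$F$. $K_{3,t}$ is the complete bipartite graph with parts of sizes $3$ and $t$. For an $r$-graph $H$ on vertex set $[n]$, its adjacency tensor $\mathcal{A}(H)$ is the order-$r$, dimension-$n$ symmetric tensor with $\mathcal{A}_{i_1\cdots i_r}=\frac{1}{(r-1)!}$ if $\{i_1,\dots,i_r\}\in E(H)$ and $0$ otherwise. For a tensor $\mathcal{T}$ and $\mathbf{x}\in\mathbb{C}^n$, $(\mathcal{T}\mathbf{x}^{r-1})_i=\sum_{i_2,\dots,i_r\in[n]}\mathcal{T}_{ii_2\cdots i_r}x_{i_2}\cdots x_{i_r}$; $\lambda\in\mathbb{C}$ is an eigenvalue if $\mathcal{T}\mathbf{x}^{r-1}=\lambda\mathbf{x}^{[r-1]}$ for some nonzero $\mathbf{x}$, where $\mathbf{x}^{[r-1]}=(x_1^{r-1},\dots,x_n^{r-1})^{T}$. The spectral radius $\rho(H)$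 is the maximum modulus of an eigenvalue of $\mathcal{A}(H)$. ${\rm spex}^{\rm lin}_r(n,\text{Berge-}K_{3,t})$ is the maximum of $\rho(H)$ over all connected Berge-$K_{3,t}$-free linear $r$-graphs $H$ on $n$ vertices. *)

theory Defs
  imports "HOL-Analysis.Analysis"
begin

(* A hypergraph is a pair (vertex set, edge set). *)
type_synonym 'a hypergraph = "'a set \<times> 'a set set"

definition uniform_hypergraph :: "nat \<Rightarrow> 'a hypergraph \<Rightarrow> bool" where
  "uniform_hypergraph r H \<longleftrightarrow> (\<forall>e\<in>snd H. e \<subseteq> fst H \<and> finite e \<and> card e = r)"

definition linear_hypergraph :: "'a hypergraph \<Rightarrow> bool" where
  "linear_hypergraph H \<longleftrightarrow> (\<forall>e\<in>snd H. \<forall>f\<in>snd H. e \<noteq> f \<longrightarrow> card (e \<inter> f) \<le> 1)"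

definition connected_hypergraph :: "'a hypergraph \<Rightarrow> bool" where
  "connected_hypergraph H \<longleftrightarrow>
     (\<forall>u\<in>fst H. \<forall>v\<in>fst H. (u, v) \<in> {(a, b). \<exists>e\<in>snd H. a \<in> e \<and> b \<in> e}\<^sup>*)"

(* F is a simple graph given as a 2-uniform hypergraph; the map f places a copy of F on the
   vertices of H, so that the inclusion of e in phi(e) makes sense for an abstract graph F. *)
definition is_berge :: "'b hypergraph \<Rightarrow> 'a hypergraph \<Rightarrow> bool" where
  "is_berge F H \<longleftrightarrow>
     (\<exists>f \<phi>. inj_on f (fst F) \<and> f ` fst F \<subseteq> fst H \<and>
            bij_betw \<phi> (snd F) (snd H) \<and> (\<forall>e\<in>snd F. f ` e \<subseteq> \<phi> e))"

definition berge_free :: "'b hypergraph \<Rightarrow> 'a hypergraph \<Rightarrow> bool" where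
  "berge_free F H \<longleftrightarrow> (\<forall>E'\<subseteq>snd H. \<not> is_berge F (fst H, E'))"

definition complete_bipartite :: "nat \<Rightarrow> nat \<Rightarrow> (nat + nat) hypergraph" where
  "complete_bipartite s t =
     ({1..s} <+> {1..t}, {{Inl i, Inr j} | i j. i \<in> {1..s} \<and> j \<in> {1..t}})"

(* A tensor of order r and dimension n is a function on index lists; only its values on lists
   of length r over {1..n} matter. Likewise for a vector x :: nat => complex and {1..n}. *)
type_synonym tensor = "nat list \<Rightarrow> complex"

(* For an r-uniform H, a list of length r with set is in E(H) is automatically distinct. *)
definition adjacency_tensor :: "nat \<Rightarrow> nat hypergraph \<Rightarrow> tensor" where
  "adjacency_tensor r H =
     (\<lambda>is. if length is = r \<and> set is \<in> snd H then 1 / fact (r - 1) else 0)"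

definition tensor_apply :: "nat \<Rightarrow> nat \<Rightarrow> tensor \<Rightarrow> (nat \<Rightarrow> complex) \<Rightarrow> nat \<Rightarrow> complex" where
  "tensor_apply r n T x i =
     (\<Sum>is | set is \<subseteq> {1..n} \<and> length is = r - 1. T (i # is) * prod_list (map x is))"

definition tensor_eigenvalue :: "nat \<Rightarrow> nat \<Rightarrow> tensor \<Rightarrow> complex \<Rightarrow> bool" where
  "tensor_eigenvalue r n T \<mu> \<longleftrightarrow>
     (\<exists>x. (\<exists>i\<in>{1..n}. x i \<noteq> 0) \<and> (\<forall>i\<in>{1..n}. tensor_apply r n T x i = \<mu> * x i ^ (r - 1)))"

(* The supremum is a maximum as soon as some eigenvalue exists: see spectral_radius_attained. *)
definition tensor_spectral_radius :: "nat \<Rightarrow> nat \<Rightarrow> tensor \<Rightarrow> real" where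
  "tensor_spectral_radius r n T = Sup {cmod \<mu> | \<mu>. tensor_eigenvalue r n T \<mu>}"

definition hypergraph_spectral_radius :: "nat \<Rightarrow> nat \<Rightarrow> nat hypergraph \<Rightarrow> real" where
  "hypergraph_spectral_radius r n H = tensor_spectral_radius r n (adjacency_tensor r H)"

definition berge_free_linear_family :: "nat \<Rightarrow> nat \<Rightarrow> 'b hypergraph \<Rightarrow> nat hypergraph set" where
  "berge_free_linear_family r n F =
     {H. fst H = {1..n} \<and> uniform_hypergraph r H \<and> linear_hypergraph H \<and>
         connected_hypergraph H \<and> berge_free F H}"

(* The family is finite: see finite_berge_free_linear_family. For some r and n it is empty, e.g. r = 3 and n = 4;
   then Max returns an unspecified value. *)
definition spex_lin :: "nat \<Rightarrow> nat \<Rightarrow> 'b hypergraph \<Rightarrow> real" where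
  "spex_lin r n F = Max (hypergraph_spectral_radius r n ` berge_free_linear_family r n F)"

lemma finite_berge_free_linear_family: "finite (berge_free_linear_family r n F)"
proof (rule finite_subset)
  show "berge_free_linear_family r n F \<subseteq> {{1..n}} \<times> Pow (Pow {1..n})"
    by (fastforce simp: berge_free_linear_family_def uniform_hypergraph_def)
qed simp

lemma continuous_on_tensor_apply: "continuous_on UNIV (\<lambda>x. tensor_apply r n T x i)"
proof -
  have "continuous_on UNIV (\<lambda>x::nat \<Rightarrow> complex. prod_list (map x is))" for "is"
    by (induction "is") (auto intro!: continuous_intros)
  then show ?thesis
    unfolding tensor_apply_def by (intro continuous_on_sum continuous_on_mult continuous_on_const)
qed

lemma tensor_apply_scale:
  "tensor_apply r n T (\<lambda>i. c * x i) i = c ^ (r - 1) * tensor_apply r n T x i"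
proof -
  have "prod_list (map (\<lambda>i. c * x i) is) = c ^ length is * prod_list (map x is)" for "is"
    by (induction "is") auto
  then show ?thesis
    unfolding tensor_apply_def sum_distrib_left by (intro sum.cong) auto
qed

lemma tensor_apply_cong:
  "(\<And>j. j \<in> {1..n} \<Longrightarrow> x j = y j) \<Longrightarrow> tensor_apply r n T x i = tensor_apply r n T y i"
  unfolding tensor_apply_def
  by (rule sum.cong) (auto intro!: arg_cong[where f = prod_list] arg_cong2[where f = "(*)"] map_cong)

lemma norm_tensor_apply_le:
  assumes "\<And>j. j \<in> {1..n} \<Longrightarrow> cmod (x j) \<le> 1"
  shows "cmod (tensor_apply r n T x i) \<le>
    (\<Sum>is | set is \<subseteq> {1..n} \<and> length is = r - 1. cmod (T (i # is)))"
proof -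
  have "cmod (prod_list (map x is)) \<le> 1" if "set is \<subseteq> {1..n}" for "is"
    using that
  proof (induction "is")
    case (Cons a l)
    then show ?case using assms[of a] by (auto simp: norm_mult intro!: mult_le_one)
  qed simp
  then show ?thesis
    unfolding tensor_apply_def
    by (intro sum_norm_le) (auto simp: norm_mult intro!: mult_left_le)
qed

theorem spectral_radius_attained:
  assumes "tensor_eigenvalue r n T \<mu>\<^sub>0"
  shows "\<exists>\<mu>. tensor_eigenvalue r n T \<mu> \<and> cmod \<mu> = tensor_spectral_radius r n T"
    and "\<And>\<mu>. tensor_eigenvalue r n T \<mu> \<Longrightarrow> cmod \<mu> \<le> tensor_spectral_radius r n T"
proof -
  define B where "B = (\<Sum>i\<in>{1..n}. \<Sum>is | set is \<subseteq> {1..n} \<and> length is = r - 1. cmod (T (i # is)))"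
  define X :: "(nat \<Rightarrow> complex) set" where "X = PiE UNIV (\<lambda>i. cball 0 1)"
  define K where "K = (cball (0::complex) B \<times> X) \<inter>
    ({p. \<exists>i\<in>{1..n}. cmod (snd p i) = 1} \<inter>
     {p. \<forall>i\<in>{1..n}. tensor_apply r n T (snd p) i = fst p * snd p i ^ (r - 1)})"
  let ?S = "{cmod \<mu> | \<mu>. tensor_eigenvalue r n T \<mu>}"
  have "compactin (product_topology (\<lambda>i. euclidean) UNIV) X"
    unfolding X_def compactin_PiE by auto
  then have X: "compact X"
    by (simp add: euclidean_product_topology)
  have coord: "continuous_on UNIV (\<lambda>p::complex \<times> (nat \<Rightarrow> complex). snd p i)" for i
    by (rule continuous_on_compose2[where g = "\<lambda>x. x i" and f = snd and t = UNIV])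
       (simp_all add: continuous_on_snd)
  have app: "continuous_on UNIV (\<lambda>p::complex \<times> (nat \<Rightarrow> complex). tensor_apply r n T (snd p) i)" for i
    by (rule continuous_on_compose2[OF continuous_on_tensor_apply]) (simp_all add: continuous_on_snd)
  have c1: "closed {p::complex \<times> (nat \<Rightarrow> complex). \<exists>i\<in>{1..n}. cmod (snd p i) = 1}"
  proof -
    have "closed {p::complex \<times> (nat \<Rightarrow> complex). cmod (snd p i) = 1}" for i
      by (intro closed_Collect_eq continuous_on_norm coord continuous_on_const)
    moreover have "{p::complex \<times> (nat \<Rightarrow> complex). \<exists>i\<in>{1..n}. cmod (snd p i) = 1} =
        (\<Union>i\<in>{1..n}. {p. cmod (snd p i) = 1})"
      by auto
    ultimately show ?thesis by (simp add: closed_UN)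
  qed
  have c2: "closed {p. \<forall>i\<in>{1..n}. tensor_apply r n T (snd p) i = fst p * snd p i ^ (r - 1)}"
    unfolding Ball_def
    by (intro closed_Collect_all closed_Collect_imp closed_Collect_eq app continuous_on_mult
        continuous_on_power coord continuous_on_fst continuous_on_id) simp
  have "compact K"
    unfolding K_def by (intro compact_Int_closed compact_Times compact_cball X closed_Int c1 c2)
  then have comp: "compact ((cmod \<circ> fst) ` K)"
    by (intro compact_continuous_image) (auto intro!: continuous_intros simp: o_def)
  have S: "?S = (cmod \<circ> fst) ` K"
  proof (intro equalityI subsetI)
    fix a assume "a \<in> (cmod \<circ> fst) ` K"
    then obtain m x where m: "a = cmod m" "(m, x) \<in> K" by auto
    then obtain i where "i \<in> {1..n}" "cmod (x i) = 1"
      unfolding K_def by auto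
    then have "\<exists>i\<in>{1..n}. x i \<noteq> 0"
      by (metis norm_zero zero_neq_one)
    moreover have "\<forall>i\<in>{1..n}. tensor_apply r n T x i = m * x i ^ (r - 1)"
      using m unfolding K_def by simp
    ultimately have "tensor_eigenvalue r n T m"
      unfolding tensor_eigenvalue_def by blast
    with m show "a \<in> ?S" by auto
  next
    fix a assume "a \<in> ?S"
    then obtain m x where a: "a = cmod m" and ex: "\<exists>i\<in>{1..n}. x i \<noteq> 0"
      and eq: "\<And>i. i \<in> {1..n} \<Longrightarrow> tensor_apply r n T x i = m * x i ^ (r - 1)"
      unfolding tensor_eigenvalue_def by blast
    define M where "M = Max ((\<lambda>i. cmod (x i)) ` {1..n})"
    have ne: "{1..n} \<noteq> {}" using ex by blast
    have le: "cmod (x i) \<le> M" if "i \<in> {1..n}" for i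
      unfolding M_def using that by (intro Max_ge) auto
    have "M \<in> (\<lambda>i. cmod (x i)) ` {1..n}"
      unfolding M_def using ne by (intro Max_in) auto
    then obtain k where k: "k \<in> {1..n}" "M = cmod (x k)" by blast
    have M: "M > 0" using ex le by (meson less_le_trans zero_less_norm_iff)
    define c where "c = complex_of_real (1 / M)"
    define y where "y = (\<lambda>i. if i \<in> {1..n} then c * x i else 0)"
    have y1: "cmod (y i) \<le> 1" for i
      using le[of i] M by (auto simp: y_def c_def norm_mult norm_divide)
    have yk: "cmod (y k) = 1"
      using k M by (auto simp: y_def c_def norm_mult norm_divide)
    have yeq: "tensor_apply r n T y i = m * y i ^ (r - 1)" if i: "i \<in> {1..n}" for i
    proof -
      have "tensor_apply r n T y i = tensor_apply r n T (\<lambda>i. c * x i) i"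
        by (rule tensor_apply_cong) (simp add: y_def)
      also have "\<dots> = m * y i ^ (r - 1)"
        using eq[OF i] i by (simp add: tensor_apply_scale y_def power_mult_distrib)
      finally show ?thesis .
    qed
    have "cmod m = cmod (tensor_apply r n T y k)"
      using yeq[OF k(1)] yk by (simp add: norm_mult norm_power)
    also have "\<dots> \<le> (\<Sum>is | set is \<subseteq> {1..n} \<and> length is = r - 1. cmod (T (k # is)))"
      by (rule norm_tensor_apply_le) (rule y1)
    also have "\<dots> \<le> B"
      unfolding B_def using k(1)
      by (intro member_le_sum[where f = "\<lambda>i. \<Sum>is | set is \<subseteq> {1..n} \<and> length is = r - 1. cmod (T (i # is))"])
         (auto intro: sum_nonneg)
    finally have "(m, y) \<in> K"
      unfolding K_def X_def using y1 yk yeq k by auto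
    then show "a \<in> (cmod \<circ> fst) ` K"
      using a by (auto intro!: image_eqI[where x = "(m, y)"])
  qed
  have ne: "?S \<noteq> {}" using assms by blast
  have bdd: "bdd_above ?S"
    unfolding S using comp by (intro bounded_imp_bdd_above compact_imp_bounded)
  have "Sup ?S \<in> ?S"
    using compact_imp_closed[OF comp] unfolding S[symmetric]
    by (intro closed_contains_Sup ne bdd)
  then show "\<exists>\<mu>. tensor_eigenvalue r n T \<mu> \<and> cmod \<mu> = tensor_spectral_radius r n T"
    unfolding tensor_spectral_radius_def by (smt (verit) mem_Collect_eq)
  show "cmod \<mu> \<le> tensor_spectral_radius r n T" if "tensor_eigenvalue r n T \<mu>" for \<mu>
    unfolding tensor_spectral_radius_def using that bdd by (intro cSup_upper) auto
qed

end

theory Submission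
  imports Defs "HOL-Combinatorics.Multiset_Permutations"
begin

text \<open>
  Take a core edge \<open>{1..r}\<close>, arrange the remaining \<open>n - r\<close> vertices in \<open>(r - 1) \<times> (r - 1)\<close> grids, and
  join every row to the vertex 1 and every column to the vertex 2. Only the vertices 1 and 2 have
  degree at least 3, so there is no Berge-\<open>K\<^bsub>3,t\<^esub>\<close>. With \<open>d = (n - r) / (r - 1)\<close>, let \<open>y\<close> be the positive
  root of \<open>y\<^sup>2 = y + d 2\<^bsup>r-1\<^esup>\<close> and \<open>\<mu> = y\<^bsup>1/r\<^esup>\<close>. The vector with entry \<open>\<mu>\<^sup>2\<close> at 1 and 2, \<open>\<mu>\<close> at
  \<open>3, \<dots>, r\<close>, and 2 elsewhere is an eigenvector for the eigenvalue \<open>\<mu>\<^sup>2\<close>, which is the claimed bound.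
\<close>

section \<open>The adjacency tensor as a sum over edges\<close>

text \<open>An edge \<open>e\<close> through \<open>i\<close> is hit by exactly the
  \<open>(r - 1)!\<close> orderings of \<open>e - {i}\<close>, and their number cancels the factor
  \<open>1 / fact (r - 1)\<close>.\<close>

lemma tensor_apply_adjacency_tensor:
  assumes H: "uniform_hypergraph r H" "fst H = {1..n}" and r: "r \<ge> 1"
  shows "tensor_apply r n (adjacency_tensor r H) x i =
    (\<Sum>e | e \<in> snd H \<and> i \<in> e. \<Prod>j\<in>e - {i}. x j)"
proof -
  let ?E = "{e \<in> snd H. i \<in> e}"
  let ?L = "{is. set is \<subseteq> {1..n} \<and> length is = r - 1}"
  let ?g = "\<lambda>is. prod_list (map x is) / fact (r - 1)"
  have e: "e \<subseteq> {1..n}" "finite e" "card e = r" if "e \<in> snd H" for e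
    using H that by (auto simp: uniform_hypergraph_def)
  have finE: "finite ?E"
    by (rule finite_subset[of _ "Pow {1..n}"]) (use e in auto)
  have finL: "finite ?L"
    using finite_lists_length_eq[of "{1..n}" "r - 1"] by simp
  \<comment> \<open>A list of length \<open>r - 1\<close> that together with \<open>i\<close> covers
    \<open>r\<close> vertices can neither repeat an entry nor contain \<open>i\<close>.\<close>
  have perm: "{is \<in> ?L. insert i (set is) = e} = permutations_of_set (e - {i})" if "e \<in> ?E" for e
  proof (intro equalityI subsetI)
    fix l assume l: "l \<in> {is \<in> ?L. insert i (set is) = e}"
    then have "set (i # l) = e" by auto
    moreover have "length (i # l) = card e" using l e[of e] that r by auto
    ultimately have "distinct (i # l)"
      using card_distinct by metis
    with l show "l \<in> permutations_of_set (e - {i})"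
      by (auto simp: permutations_of_set_def)
  next
    fix l assume "l \<in> permutations_of_set (e - {i})"
    then show "l \<in> {is \<in> ?L. insert i (set is) = e}"
      using e[of e] that distinct_card[of l] by (auto simp: permutations_of_set_def)
  qed
  have "tensor_apply r n (adjacency_tensor r H) x i =
      (\<Sum>is\<in>?L. if insert i (set is) \<in> snd H then ?g is else 0)"
    unfolding tensor_apply_def adjacency_tensor_def using r by (intro sum.cong) auto
  also have "\<dots> = (\<Sum>is | is \<in> ?L \<and> insert i (set is) \<in> ?E. ?g is)"
    using finL by (subst sum.inter_filter[symmetric]) auto
  also have "\<dots> = (\<Sum>e\<in>?E. \<Sum>is | is \<in> {is \<in> ?L. insert i (set is) \<in> ?E} \<and> insert i (set is) = e. ?g is)"
    using finE by (intro sum.group[symmetric] finite_subset[OF _ finL]) auto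
  also have "\<dots> = (\<Sum>e\<in>?E. \<Prod>j\<in>e - {i}. x j)"
  proof (rule sum.cong)
    fix f assume f: "f \<in> ?E"
    have "{is. is \<in> {is \<in> ?L. insert i (set is) \<in> ?E} \<and> insert i (set is) = f} =
        permutations_of_set (f - {i})"
      using perm[OF f] f by auto
    moreover have "(\<Sum>is\<in>permutations_of_set (f - {i}). ?g is) =
        (\<Sum>is\<in>permutations_of_set (f - {i}). (\<Prod>j\<in>f - {i}. x j) / fact (r - 1))"
    proof (rule sum.cong)
      fix l assume "l \<in> permutations_of_set (f - {i})"
      then have "set l = f - {i}" "distinct l"
        by (auto dest: permutations_of_setD)
      then show "?g l = (\<Prod>j\<in>f - {i}. x j) / fact (r - 1)"
        by (metis prod.distinct_set_conv_list)
    qed simp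
    moreover have "\<dots> = (\<Prod>j\<in>f - {i}. x j)"
      using f e[of f] by simp
    ultimately show "(\<Sum>is | is \<in> {is \<in> ?L. insert i (set is) \<in> ?E} \<and> insert i (set is) = f. ?g is) =
        (\<Prod>j\<in>f - {i}. x j)"
      by simp
  qed simp
  finally show ?thesis .
qed

section \<open>A degree criterion for Berge-freeness\<close>

text \<open>In a Berge copy, injectivity of \<open>\<phi>\<close> puts each of the \<open>s\<close>
  vertices \<open>f (Inl i)\<close> into \<open>t\<close> different edges, and injectivity of
  \<open>f\<close> keeps these vertices distinct. So a copy needs \<open>s\<close> vertices of
  degree at least \<open>t\<close>.\<close>

lemma berge_free_complete_bipartiteI:
  assumes fin: "finite (snd H)"
    and deg: "card {v \<in> fst H. card {e \<in> snd H. v \<in> e} \<ge> t} < s"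
    and V: "finite (fst H)"
  shows "berge_free (complete_bipartite s t) H"
  unfolding berge_free_def
proof (intro allI impI notI)
  fix E' assume E': "E' \<subseteq> snd H" and "is_berge (complete_bipartite s t) (fst H, E')"
  then obtain f \<phi> where f: "inj_on f ({1..s} <+> {1..t})" "f ` ({1..s} <+> {1..t}) \<subseteq> fst H"
    and \<phi>: "bij_betw \<phi> {{Inl i, Inr j} | i j. i \<in> {1..s} \<and> j \<in> {1..t}} E'"
    and \<phi>_sub: "\<forall>e\<in>{{Inl i, Inr j} | i j. i \<in> {1..s} \<and> j \<in> {1..t}}. f ` e \<subseteq> \<phi> e"
    unfolding is_berge_def complete_bipartite_def fst_conv snd_conv by blast
  have inc: "f ` {Inl i, Inr j} \<subseteq> \<phi> {Inl i, Inr j}" if "i \<in> {1..s}" "j \<in> {1..t}" for i j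
    by (rule \<phi>_sub[rule_format]) (use that in blast)
  have "t \<le> card {e \<in> snd H. f (Inl i) \<in> e}" if i: "i \<in> {1..s}" for i
  proof -
    have "inj_on (\<lambda>j. \<phi> {Inl i, Inr j}) {1..t}"
    proof (rule inj_onI)
      fix j j' assume j: "j \<in> {1..t}" "j' \<in> {1..t}" and "\<phi> {Inl i, Inr j} = \<phi> {Inl i, Inr j'}"
      then have "{Inl i, Inr j} = {Inl i, Inr j'}"
        using i by (intro inj_onD[OF bij_betw_imp_inj_on[OF \<phi>]]) auto
      then show "j = j'" by (auto simp: doubleton_eq_iff)
    qed
    moreover have "(\<lambda>j. \<phi> {Inl i, Inr j}) ` {1..t} \<subseteq> {e \<in> snd H. f (Inl i) \<in> e}"
    proof (intro image_subsetI CollectI conjI)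
      fix j assume j: "j \<in> {1..t}"
      then have "\<phi> {Inl i, Inr j} \<in> E'"
        using i by (intro bij_betw_apply[OF \<phi>]) blast
      then show "\<phi> {Inl i, Inr j} \<in> snd H" using E' by blast
      show "f (Inl i) \<in> \<phi> {Inl i, Inr j}" using inc[OF i j] by simp
    qed
    ultimately show ?thesis
      using card_inj_on_le[of "\<lambda>j. \<phi> {Inl i, Inr j}" "{1..t}" "{e \<in> snd H. f (Inl i) \<in> e}"] fin
      by simp
  qed
  then have "(\<lambda>i. f (Inl i)) ` {1..s} \<subseteq> {v \<in> fst H. card {e \<in> snd H. v \<in> e} \<ge> t}"
    using f(2) by auto
  moreover have "inj_on (\<lambda>i. f (Inl i)) {1..s}"
    using f(1) by (auto simp: inj_on_def)
  ultimately have "s \<le> card {v \<in> fst H. card {e \<in> snd H. v \<in> e} \<ge> t}"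
    using card_inj_on_le[of "\<lambda>i. f (Inl i)" "{1..s}"] V by simp
  with deg show False by simp
qed

lemma hypergraph_spectral_radius_le_spex_lin:
  assumes "H \<in> berge_free_linear_family r n F"
  shows "hypergraph_spectral_radius r n H \<le> spex_lin r n F"
  unfolding spex_lin_def using assms
  by (intro Max_ge finite_imageI[OF finite_berge_free_linear_family] imageI)

section \<open>The grid hypergraph and its membership in the family\<close>

text \<open>The functions \<open>f\<close> and \<open>g\<close> number the row and the column of a vertex outside the core.\<close>

locale grid_hypergraph =
  fixes r n d :: nat and f g :: "nat \<Rightarrow> nat"
  assumes r: "r \<ge> 2" and n: "n \<ge> r"
    and f_less: "\<And>u. u \<in> {r<..n} \<Longrightarrow> f u < d"
    and g_less: "\<And>u. u \<in> {r<..n} \<Longrightarrow> g u < d"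
    and card_row: "\<And>k. k < d \<Longrightarrow> card {u \<in> {r<..n}. f u = k} = r - 1"
    and card_column: "\<And>k. k < d \<Longrightarrow> card {u \<in> {r<..n}. g u = k} = r - 1"
    and inj: "\<And>u v. u \<in> {r<..n} \<Longrightarrow> v \<in> {r<..n} \<Longrightarrow> f u = f v \<Longrightarrow> g u = g v \<Longrightarrow> u = v"
begin

definition row :: "nat \<Rightarrow> nat set" where "row k = {u \<in> {r<..n}. f u = k}"

definition column :: "nat \<Rightarrow> nat set" where "column k = {u \<in> {r<..n}. g u = k}"

definition H :: "nat hypergraph" where
  "H = ({1..n}, insert {1..r} ((\<lambda>k. insert 1 (row k)) ` {..<d} \<union> (\<lambda>k. insert 2 (column k)) ` {..<d}))"

lemma fst_H: "fst H = {1..n}"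
  by (simp add: H_def)

lemma finite_H: "finite (fst H)" "finite (snd H)"
  by (simp_all add: H_def)

lemma edge_cases:
  assumes "e \<in> snd H"
  obtains "e = {1..r}"
    | k where "k < d" "e = insert 1 (row k)"
    | k where "k < d" "e = insert 2 (column k)"
  using assms by (auto simp: H_def)

lemma finite_row: "finite (row k)" and finite_column: "finite (column k)"
  by (simp_all add: row_def column_def)

lemma not_in_row: "u \<le> r \<Longrightarrow> u \<notin> row k" and not_in_column: "u \<le> r \<Longrightarrow> u \<notin> column k"
  by (simp_all add: row_def column_def)

lemma uniform_H: "uniform_hypergraph r H"
  unfolding uniform_hypergraph_def
proof
  fix e assume "e \<in> snd H"
  then show "e \<subseteq> fst H \<and> finite e \<and> card e = r"
  proof (cases rule: edge_cases)
    case 1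
    then show ?thesis using n by (auto simp: fst_H)
  next
    case (2 k)
    then show ?thesis
      using r n card_row[of k] not_in_row[of 1 k] finite_row[of k] by (auto simp: fst_H row_def)
  next
    case (3 k)
    then show ?thesis
      using r n card_column[of k] not_in_column[of 2 k] finite_column[of k]
      by (auto simp: fst_H column_def)
  qed
qed

text \<open>Edges through the same hub 1 or 2 share only that hub, because different rows are
  disjoint, as are different columns, and the core avoids the grid. A row edge and a column edge can
  share only a grid vertex, which its two numbers determine.\<close>

lemma linear_H: "linear_hypergraph H"
proof -
  have small: "card A \<le> 1" if "\<And>u v. u \<in> A \<Longrightarrow> v \<in> A \<Longrightarrow> u = v" for A :: "nat set"
    using that by (cases "finite A") (auto simp: card_le_Suc0_iff_eq)
  have row_D: "r < u" "f u = k" if "u \<in> row k" for u k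
    using that by (auto simp: row_def)
  have column_D: "r < u" "g u = k" if "u \<in> column k" for u k
    using that by (auto simp: column_def)
  have core_row: "card ({1..r} \<inter> insert 1 (row k)) \<le> 1" for k
    by (rule small) (auto dest: row_D(1))
  have core_column: "card ({1..r} \<inter> insert 2 (column k)) \<le> 1" for k
    by (rule small) (auto dest: column_D(1))
  have row_row: "card (insert 1 (row k) \<inter> insert 1 (row l)) \<le> 1" if "k \<noteq> l" for k l
    by (rule small) (use that r in \<open>auto dest: row_D\<close>)
  have column_column: "card (insert 2 (column k) \<inter> insert 2 (column l)) \<le> 1" if "k \<noteq> l" for k l
    by (rule small) (use that r in \<open>auto dest: column_D\<close>)
  have row_column: "card (insert 1 (row k) \<inter> insert 2 (column l)) \<le> 1" for k l
  proof (rule small)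
    \<comment> \<open>Neither hub is common to both edges: 1 and 2 are at most \<open>r\<close>,
      hence outside every row and column.\<close>
    have "w \<in> row k \<and> w \<in> column l" if "w \<in> insert 1 (row k) \<inter> insert 2 (column l)" for w
      using that r not_in_row[of 2 k] not_in_column[of 1 l] by auto
    moreover fix u v
    assume "u \<in> insert 1 (row k) \<inter> insert 2 (column l)" "v \<in> insert 1 (row k) \<inter> insert 2 (column l)"
    ultimately have "u \<in> row k" "u \<in> column l" "v \<in> row k" "v \<in> column l" by blast+
    then show "u = v"
      by (intro inj[of u v]) (simp_all add: row_def column_def)
  qed
  have "card (e \<inter> e') \<le> 1" if e: "e \<in> snd H" and e': "e' \<in> snd H" and ne: "e \<noteq> e'" for e e'
    using e
  proof (cases rule: edge_cases)
    case e1: 1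
    from e' show ?thesis
    proof (cases rule: edge_cases)
      case 1
      with e1 ne show ?thesis by blast
    next
      case (2 l)
      then show ?thesis unfolding e1 by (simp only: core_row)
    next
      case (3 l)
      then show ?thesis unfolding e1 by (simp only: core_column)
    qed
  next
    case e2: (2 k)
    from e' show ?thesis
    proof (cases rule: edge_cases)
      case 1
      then show ?thesis unfolding e2(2) using core_row[of k] by (simp only: Int_commute)
    next
      case (2 l)
      with e2(2) ne have "k \<noteq> l" by blast
      then show ?thesis unfolding e2(2) 2(2) by (rule row_row)
    next
      case (3 l)
      then show ?thesis unfolding e2(2) by (simp only: row_column)
    qed
  next
    case e3: (3 k)
    from e' show ?thesis
    proof (cases rule: edge_cases)
      case 1
      then show ?thesis unfolding e3(2) using core_column[of k] by (simp only: Int_commute)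
    next
      case (2 l)
      then show ?thesis unfolding e3(2) using row_column[of l k] by (simp only: Int_commute)
    next
      case (3 l)
      with e3(2) ne have "k \<noteq> l" by blast
      then show ?thesis unfolding e3(2) 3(2) by (rule column_column)
    qed
  qed
  then show ?thesis by (simp add: linear_hypergraph_def)
qed

text \<open>Every vertex shares an edge with the vertex 1: a core vertex through
  \<open>{1..r}\<close>, a grid vertex through its row.\<close>

lemma connected_H: "connected_hypergraph H"
proof -
  let ?R = "{(a, b). \<exists>e\<in>snd H. a \<in> e \<and> b \<in> e}"
  have R: "(u, 1) \<in> ?R\<^sup>*" "(1, u) \<in> ?R\<^sup>*" if u: "u \<in> {1..n}" for u
  proof -
    obtain e where "e \<in> snd H" "1 \<in> e" "u \<in> e"
    proof (cases "u \<le> r")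
      case True
      then show ?thesis using that[of "{1..r}"] u r by (simp add: H_def)
    next
      case False
      then have "insert 1 (row (f u)) \<in> snd H" "u \<in> row (f u)"
        using u f_less[of u] by (auto simp: H_def row_def)
      then show ?thesis using that[of "insert 1 (row (f u))"] by simp
    qed
    then have "(u, 1) \<in> ?R" "(1, u) \<in> ?R" by auto
    then show "(u, 1) \<in> ?R\<^sup>*" "(1, u) \<in> ?R\<^sup>*" by (simp_all only: r_into_rtrancl)
  qed
  show ?thesis
    unfolding connected_hypergraph_def fst_H
    by (intro ballI rtrancl_trans[OF R(1) R(2)])
qed

section \<open>Edges at each type of vertex, and degrees\<close>

lemma edges_at_1: "{e \<in> snd H. 1 \<in> e} = insert {1..r} ((\<lambda>k. insert 1 (row k)) ` {..<d})"
  using r by (auto simp: H_def not_in_column)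

lemma edges_at_2: "{e \<in> snd H. 2 \<in> e} = insert {1..r} ((\<lambda>k. insert 2 (column k)) ` {..<d})"
  using r by (auto simp: H_def not_in_row)

lemma edges_at_core: "u \<in> {3..r} \<Longrightarrow> {e \<in> snd H. u \<in> e} = {{1..r}}"
  by (auto simp: H_def not_in_row not_in_column)

lemma edges_at_grid:
  "u \<in> {r<..n} \<Longrightarrow> {e \<in> snd H. u \<in> e} = {insert 1 (row (f u)), insert 2 (column (g u))}"
  using r f_less g_less by (auto simp: H_def row_def column_def)

lemma vertex_cases:
  assumes "u \<in> {1..n}"
  obtains "u = 1" | "u = 2" | "u \<in> {3..r}" | "u \<in> {r<..n}"
proof -
  have "u = 1 \<or> u = 2 \<or> u \<in> {3..r} \<or> u \<in> {r<..n}" using assms by auto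
  then show ?thesis using that by blast
qed

text \<open>The vertices \<open>3, ..., r\<close> have degree 1 and grid vertices have degree at
  most 2, so only the two hubs can reach degree \<open>t\<close>, while the small side of the
  bipartite graph has three vertices.\<close>

lemma berge_free_H:
  assumes "t \<ge> 3"
  shows "berge_free (complete_bipartite 3 t) H"
proof (rule berge_free_complete_bipartiteI)
  have "u \<in> {1, 2}" if "u \<in> fst H" "card {e \<in> snd H. u \<in> e} \<ge> t" for u
  proof -
    from that have "u \<in> {1..n}" by (simp add: fst_H)
    then show ?thesis
    proof (cases rule: vertex_cases)
      case 3
      then show ?thesis using that assms by (simp add: edges_at_core)
    next
      case 4
      then show ?thesis using that assms
        by (simp add: edges_at_grid card_insert_if split: if_splits)
    qed auto
  qed
  then have "card {v \<in> fst H. card {e \<in> snd H. v \<in> e} \<ge> t} \<le> card {1, 2::nat}"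
    by (intro card_mono) auto
  then show "card {v \<in> fst H. card {e \<in> snd H. v \<in> e} \<ge> t} < 3" by simp
qed (fact finite_H)+

lemma H_in_family: "t \<ge> 3 \<Longrightarrow> H \<in> berge_free_linear_family r n (complete_bipartite 3 t)"
  by (simp add: berge_free_linear_family_def fst_H uniform_H linear_H connected_H berge_free_H)

section \<open>The explicit eigenvector\<close>

text \<open>Allows the sum over the row edges at 1 to be taken over their \<open>d\<close> indices.
  A row is nonempty since \<open>r - 1 > 0\<close>, so it determines its index.\<close>

lemma inj_row: "inj_on (\<lambda>k. insert 1 (row k)) {..<d}"
proof (rule inj_onI)
  fix k l assume k: "k \<in> {..<d}" and "insert 1 (row k) = insert 1 (row l)"
  then have "row k = row l" using r by (simp add: insert_ident not_in_row)
  moreover have "row k \<noteq> {}" using card_row[of k, folded row_def] k r by force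
  ultimately show "k = l" unfolding row_def by blast
qed

lemma inj_column: "inj_on (\<lambda>k. insert 2 (column k)) {..<d}"
proof (rule inj_onI)
  fix k l assume k: "k \<in> {..<d}" and "insert 2 (column k) = insert 2 (column l)"
  then have "column k = column l" using r by (simp add: insert_ident not_in_column)
  moreover have "column k \<noteq> {}" using card_column[of k, folded column_def] k r by force
  ultimately show "k = l" unfolding column_def by blast
qed

text \<open>The equation for \<open>\<mu>\<close> is the eigenvalue equation at the vertices 1 and
  2: the core contributes \<open>\<mu> ^ r\<close> and each of the \<open>d\<close> rows or columns
  \<open>2 ^ (r - 1)\<close>. At the other vertices the choice of entries makes both sides
  agree.\<close>

lemma eigenvalue_H:
  fixes \<mu> :: complex
  assumes \<mu>: "(\<mu> ^ r)\<^sup>2 = \<mu> ^ r + of_nat d * 2 ^ (r - 1)" "\<mu> \<noteq> 0"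
  shows "tensor_eigenvalue r n (adjacency_tensor r H) (\<mu>\<^sup>2)"
proof -
  \<comment> \<open>A grid entry \<open>c\<close> must satisfy
    \<open>2 * \<mu>^2 * c ^ (r - 2) = \<mu>^2 * c ^ (r - 1)\<close>, one term for each of its two
    edges; this gives \<open>c = 2\<close>.\<close>
  define x where "x = (\<lambda>i. if i \<le> 2 then \<mu>\<^sup>2 else if i \<le> r then \<mu> else 2)"
  define P where "P = (\<lambda>u e. \<Prod>j\<in>e - {u}. x j)"
  obtain m where m: "r = m + 2"
    using r by (metis add.commute le_Suc_ex)
  have row: "(\<Prod>j\<in>row k. x j) = 2 ^ (r - 1)" and column: "(\<Prod>j\<in>column k. x j) = 2 ^ (r - 1)"
    if "k < d" for k
  proof -
    have "(\<Prod>j\<in>row k. x j) = (\<Prod>j\<in>row k. 2)" "(\<Prod>j\<in>column k. x j) = (\<Prod>j\<in>column k. 2)"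
      using r by (auto simp: row_def column_def x_def intro!: prod.cong)
    then show "(\<Prod>j\<in>row k. x j) = 2 ^ (r - 1)" "(\<Prod>j\<in>column k. x j) = 2 ^ (r - 1)"
      using card_row[OF that] card_column[OF that] by (simp_all add: row_def column_def)
  qed
  have rest: "(\<Prod>j\<in>A. x j) = \<mu> ^ card A" if "A \<subseteq> {3..r}" for A
  proof -
    have "(\<Prod>j\<in>A. x j) = (\<Prod>j\<in>A. \<mu>)"
      using that by (intro prod.cong) (auto simp: x_def)
    then show ?thesis by simp
  qed
  have "(\<mu> ^ r)\<^sup>2 = (\<mu>\<^sup>2) ^ Suc (r - 1)"
    using r by (simp add: mult.commute flip: power_mult)
  then have \<mu>_power: "\<mu> ^ r + of_nat d * 2 ^ (r - 1) = \<mu>\<^sup>2 * (\<mu>\<^sup>2) ^ (r - 1)"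
    unfolding \<mu>(1) power_Suc .
  have "tensor_apply r n (adjacency_tensor r H) x u = \<mu>\<^sup>2 * x u ^ (r - 1)" if "u \<in> {1..n}" for u
  proof -
    have "tensor_apply r n (adjacency_tensor r H) x u = sum (P u) {e \<in> snd H. u \<in> e}"
      using tensor_apply_adjacency_tensor[OF uniform_H fst_H] r by (simp add: P_def)
    also have "\<dots> = \<mu>\<^sup>2 * x u ^ (r - 1)"
      using that
    proof (cases rule: vertex_cases)
      case 1
      \<comment> \<open>The core must differ from all row edges for its term to split off from the
        sum.\<close>
      have "{1..r} \<notin> (\<lambda>k. insert 1 (row k)) ` {..<d}"
      proof
        assume "{1..r} \<in> (\<lambda>k. insert 1 (row k)) ` {..<d}"
        then obtain k where "{1..r} = insert 1 (row k)" by auto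
        moreover have "2 \<in> {1..r}" using r by simp
        ultimately show False using not_in_row[of 2 k] r by auto
      qed
      then have "sum (P u) {e \<in> snd H. u \<in> e} = P 1 {1..r} + (\<Sum>k<d. P 1 (insert 1 (row k)))"
        unfolding 1 edges_at_1 using sum.reindex[OF inj_row, of "P 1"] by simp
      moreover have "{1..r} - {1} = insert 2 {3..r}" using r by auto
      then have "P 1 {1..r} = \<mu> ^ r"
        unfolding P_def using rest[of "{3..r}"] by (simp add: x_def m power2_eq_square)
      moreover have "(\<Sum>k<d. P 1 (insert 1 (row k))) = of_nat d * 2 ^ (r - 1)"
        using r row by (simp add: P_def not_in_row)
      moreover have "x u = \<mu>\<^sup>2" by (simp add: 1 x_def)
      ultimately show ?thesis by (simp only: \<mu>_power)
    next
      case 2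
      have "{1..r} \<notin> (\<lambda>k. insert 2 (column k)) ` {..<d}"
      proof
        assume "{1..r} \<in> (\<lambda>k. insert 2 (column k)) ` {..<d}"
        then obtain k where "{1..r} = insert 2 (column k)" by auto
        moreover have "1 \<in> {1..r}" using r by simp
        ultimately show False using not_in_column[of 1 k] r by auto
      qed
      then have "sum (P u) {e \<in> snd H. u \<in> e} = P 2 {1..r} + (\<Sum>k<d. P 2 (insert 2 (column k)))"
        unfolding 2 edges_at_2 using sum.reindex[OF inj_column, of "P 2"] by simp
      moreover have "{1..r} - {2} = insert 1 {3..r}" using r by auto
      then have "P 2 {1..r} = \<mu> ^ r"
        unfolding P_def using rest[of "{3..r}"] by (simp add: x_def m power2_eq_square)
      moreover have "(\<Sum>k<d. P 2 (insert 2 (column k))) = of_nat d * 2 ^ (r - 1)"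
        using r column by (simp add: P_def not_in_column)
      moreover have "x u = \<mu>\<^sup>2" by (simp add: 2 x_def)
      ultimately show ?thesis by (simp only: \<mu>_power)
    next
      case 3
      have "{1..r} - {u} = insert 1 (insert 2 ({3..r} - {u}))" using 3 by auto
      moreover have "card ({3..r} - {u}) = r - 3" using 3 by simp
      ultimately have "P u {1..r} = \<mu>\<^sup>2 * (\<mu>\<^sup>2 * \<mu> ^ (r - 3))"
        unfolding P_def using rest[of "{3..r} - {u}"] by (simp add: x_def)
      \<comment> \<open>This case has \<open>r \<ge> 3\<close>, so the subtraction
        \<open>r - 3\<close> is not truncated.\<close>
      moreover have "r - 1 = 2 + (r - 3)" using 3 unfolding atLeastAtMost_iff by linarith
      then have "\<mu>\<^sup>2 * \<mu> ^ (r - 3) = \<mu> ^ (r - 1)" by (simp only: power_add)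
      moreover have "x u = \<mu>" using 3 by (simp add: x_def)
      ultimately show ?thesis
        unfolding edges_at_core[OF 3] by simp
    next
      case 4
      have x: "x u = 2" using 4 r by (simp add: x_def)
      \<comment> \<open>Multiplying by \<open>x u = 2\<close> completes the product to the whole
        edge, so the exponent \<open>r - 2\<close> never appears; the factor 2 is cancelled at the
        end.\<close>
      have "P u (insert 1 (row (f u))) * x u = (\<Prod>j\<in>insert 1 (row (f u)). x j)"
        unfolding P_def using 4 finite_row[of "f u"]
        by (subst prod.remove[of _ u]) (auto simp: row_def mult.commute)
      also have "\<dots> = \<mu>\<^sup>2 * 2 ^ (r - 1)"
        using row[OF f_less[OF 4]] not_in_row[of 1] finite_row r by (simp add: x_def)
      finally have p1: "P u (insert 1 (row (f u))) * x u = \<mu>\<^sup>2 * 2 ^ (r - 1)" .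
      have "P u (insert 2 (column (g u))) * x u = (\<Prod>j\<in>insert 2 (column (g u)). x j)"
        unfolding P_def using 4 finite_column[of "g u"]
        by (subst prod.remove[of _ u]) (auto simp: column_def mult.commute)
      also have "\<dots> = \<mu>\<^sup>2 * 2 ^ (r - 1)"
        using column[OF g_less[OF 4]] not_in_column[of 2] finite_column r by (simp add: x_def)
      finally have p2: "P u (insert 2 (column (g u))) * x u = \<mu>\<^sup>2 * 2 ^ (r - 1)" .
      have "insert 1 (row (f u)) \<noteq> insert 2 (column (g u))"
        using r not_in_column[of 1 "g u"] by auto
      then have "sum (P u) {e \<in> snd H. u \<in> e} =
          P u (insert 1 (row (f u))) + P u (insert 2 (column (g u)))"
        unfolding edges_at_grid[OF 4] by simp
      then have "sum (P u) {e \<in> snd H. u \<in> e} * 2 = (\<mu>\<^sup>2 * 2 ^ (r - 1)) * 2"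
        using p1 p2 unfolding x by (simp only: distrib_right mult_2_right[of "\<mu>\<^sup>2 * 2 ^ (r - 1)"])
      then have "sum (P u) {e \<in> snd H. u \<in> e} = \<mu>\<^sup>2 * 2 ^ (r - 1)"
        by (rule mult_right_cancel[THEN iffD1, rotated]) simp
      then show ?thesis unfolding x .
    qed
    finally show ?thesis .
  qed
  moreover have "1 \<in> {1..n}" "x 1 \<noteq> 0"
    using r n \<mu>(2) by (auto simp: x_def)
  ultimately show ?thesis
    unfolding tensor_eigenvalue_def by blast
qed

end

section \<open>Numbering the grid vertices\<close>

text \<open>With \<open>q = r - 1\<close>, write the offset \<open>u - r - 1\<close> as
  \<open>q * q * a + q * b + s\<close> with \<open>b, s < q\<close>: grid \<open>a\<close>, row
  \<open>b\<close> and column \<open>s\<close> inside it. The global numbers are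
  \<open>q * a + b\<close> for the row and \<open>q * a + s\<close> for the column.\<close>

lemma grid_hypergraph_exists:
  fixes r n :: nat
  assumes r: "r \<ge> 2" and n: "n \<ge> r" and dvd: "(r - 1)\<^sup>2 dvd n - r"
  shows "\<exists>f g. grid_hypergraph r n ((n - r) div (r - 1)) f g"
proof -
  define q where "q = r - 1"
  have q: "q > 0" using r by (simp add: q_def)
  obtain c where c: "n - r = q * q * c"
    using dvd by (auto simp: q_def power2_eq_square)
  have d: "(n - r) div (r - 1) = q * c"
    using q by (simp add: c mult.assoc flip: q_def del: One_nat_def)
  \<comment> \<open>The first grid vertex is \<open>r + 1\<close>, so offsets start at 0. The
    quotient by \<open>q\<close> is already \<open>q * a + b\<close>.\<close>
  define f where "f = (\<lambda>u. (u - r - 1) div q)"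
  define g where "g = (\<lambda>u. q * ((u - r - 1) div (q * q)) + (u - r - 1) mod q)"
  have less: "u - r - 1 < q * q * c" if "u \<in> {r<..n}" for u
    using that c by auto
  have dq: "q * a + s < q * c" if "a < c" "s < q" for a s
  proof -
    have "q * a + s < q * Suc a" using that by simp
    also have "\<dots> \<le> q * c" using that by (intro mult_le_mono2) simp
    finally show ?thesis .
  qed
  have "grid_hypergraph r n (q * c) f g"
  proof
    fix u assume u: "u \<in> {r<..n}"
    show "f u < q * c"
      using less[OF u] unfolding f_def by (intro less_mult_imp_div_less) (simp add: ac_simps)
    show "g u < q * c"
      unfolding g_def using less[OF u] q
      by (intro dq less_mult_imp_div_less) (simp_all add: ac_simps)
  next
    fix k assume k: "k < q * c"
    have "q * k + s < q * q * c" if "s < q" for s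
    proof -
      have "q * k + s < q * Suc k" using that by simp
      also have "\<dots> \<le> q * (q * c)" using k by (intro mult_le_mono2) simp
      finally show ?thesis by (simp add: ac_simps)
    qed
    \<comment> \<open>Row \<open>k\<close> is a block of \<open>q\<close> consecutive offsets
      starting at \<open>q * k\<close>.\<close>
    then have "bij_betw (\<lambda>s. r + 1 + (q * k + s)) {..<q} {u \<in> {r<..n}. f u = k}"
      using c n q
      by (intro bij_betw_byWitness[where f' = "\<lambda>u. (u - r - 1) mod q"])
         (fastforce simp: f_def)+
    from bij_betw_same_card[OF this] show "card {u \<in> {r<..n}. f u = k} = r - 1"
      by (simp only: card_lessThan q_def)
  next
    fix k assume k: "k < q * c"
    have kq: "k div q < c" using k by (intro less_mult_imp_div_less) (simp add: ac_simps)
    \<comment> \<open>The offset of the vertex in grid \<open>k div q\<close>, row \<open>j\<close>,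
      column \<open>k mod q\<close>; letting \<open>j\<close> run below \<open>q\<close> lists
      column \<open>k\<close>.\<close>
    let ?h = "\<lambda>j. q * (q * (k div q) + j) + k mod q"
    have h: "?h j < q * q * c" "?h j div q mod q = j" "?h j div (q * q) = k div q" "?h j mod q = k mod q"
      if "j < q" for j
    proof -
      have "q * (k div q) + j < q * c" using kq that by (rule dq)
      then have "q * Suc (q * (k div q) + j) \<le> q * (q * c)"
        by (intro mult_le_mono2) simp
      moreover have "k mod q < q" using q by simp
      ultimately show "?h j < q * q * c" by (simp add: ac_simps)
      show "?h j div q mod q = j" "?h j div (q * q) = k div q" "?h j mod q = k mod q"
        using that q by (simp_all add: div_mult2_eq)
    qed
    have inverse: "?h (m div q mod q) = m" if "q * (m div (q * q)) + m mod q = k" for m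
    proof -
      have "k div q = m div q div q" "k mod q = m mod q"
        using that q by (auto simp: div_mult2_eq)
      then show ?thesis by simp
    qed
    have "bij_betw (\<lambda>j. r + 1 + ?h j) {..<q} {u \<in> {r<..n}. g u = k}"
    proof (intro bij_betw_byWitness[where f' = "\<lambda>u. (u - r - 1) div q mod q"] ballI subsetI)
      fix j assume "j \<in> {..<q}"
      then show "(r + 1 + ?h j - r - 1) div q mod q = j" using h(2)[of j] by simp
    next
      fix u assume "u \<in> {u \<in> {r<..n}. g u = k}"
      then show "r + 1 + ?h ((u - r - 1) div q mod q) = u"
        using inverse[of "u - r - 1"] by (simp add: g_def)
    next
      fix u assume "u \<in> (\<lambda>j. r + 1 + ?h j) ` {..<q}"
      then obtain j where j: "j < q" "u = r + 1 + ?h j" by auto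
      then have "u - r - 1 = ?h j" by simp
      then have "g u = k" unfolding g_def using h[OF j(1)] by simp
      then show "u \<in> {u \<in> {r<..n}. g u = k}" using j h(1)[OF j(1)] c n by simp
    next
      fix j assume "j \<in> (\<lambda>u. (u - r - 1) div q mod q) ` {u \<in> {r<..n}. g u = k}"
      then show "j \<in> {..<q}" using q by auto
    qed
    from bij_betw_same_card[OF this] show "card {u \<in> {r<..n}. g u = k} = r - 1"
      by (simp only: card_lessThan q_def)
  next
    fix u v assume uv: "u \<in> {r<..n}" "v \<in> {r<..n}" "f u = f v" "g u = g v"
    \<comment> \<open>The column number gives the remainder of the offset modulo \<open>q\<close>
      and the row number its quotient, so the two recover the vertex.\<close>
    have "g w mod q = (w - r - 1) mod q" for w by (simp add: g_def)
    then have "(u - r - 1) mod q = (v - r - 1) mod q" using uv(4) by metis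
    with uv(3) have "u - r - 1 = v - r - 1"
      unfolding f_def by (metis div_mult_mod_eq)
    with uv show "u = v" by auto
  qed (fact r n)+
  then show ?thesis using d by auto
qed

section \<open>The lower bound\<close>

theorem theorem1p3:
  fixes r t n :: nat
  assumes "t > r" and "r \<ge> 2" and "n \<ge> r" and "(r - 1) ^ r dvd n - r"
  shows "spex_lin r n (complete_bipartite 3 t) \<ge>
    2 powr (- 2 / real r) *
      (sqrt (1 + (real n - real r) * 2 ^ (r + 1) / (real r - 1)) + 1) powr (2 / real r)"
proof -
  define d where "d = (n - r) div (r - 1)"
  have "(r - 1)\<^sup>2 dvd n - r"
    using assms(2,4) dvd_trans le_imp_power_dvd by blast
  then obtain f g where "grid_hypergraph r n d f g"
    using grid_hypergraph_exists assms unfolding d_def by blast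
  then interpret grid_hypergraph r n d f g .
  have "r - 1 dvd n - r"
    using \<open>(r - 1)\<^sup>2 dvd n - r\<close> by (metis dvd_mult_left power2_eq_square)
  \<comment> \<open>The division is exact, so the natural-number quotient \<open>d\<close> equals
    the real one.\<close>
  then have "real d = (real n - real r) / (real r - 1)"
    unfolding d_def using assms by (simp add: real_of_nat_div of_nat_diff)
  then have d: "(real n - real r) * 2 ^ (r + 1) / (real r - 1) = real d * 2 ^ (r + 1)"
    by simp
  define D where "D = 1 + real d * 2 ^ (r + 1)"
  \<comment> \<open>The positive root of \<open>y^2 - y - d * 2 ^ (r - 1) = 0\<close>, whose
    discriminant is \<open>D\<close> because \<open>4 * 2 ^ (r - 1) = 2 ^ (r + 1)\<close>.\<close>
  define y where "y = (sqrt D + 1) / 2"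
  have D: "D \<ge> 0" by (simp add: D_def)
  have y: "y > 0" using D by (simp add: y_def add_nonneg_pos)
  have "y\<^sup>2 = y + (D - 1) / 4"
    using D by (simp add: y_def power2_eq_square field_simps)
  also have "(D - 1) / 4 = real d * 2 ^ (r - 1)"
    using assms(2) by (cases r) (simp_all add: D_def)
  finally have yy: "y\<^sup>2 = y + real d * 2 ^ (r - 1)" .
  define \<mu> where "\<mu> = y powr (1 / real r)"
  have \<mu>: "\<mu> > 0" using y by (simp add: \<mu>_def)
  have "\<mu> ^ r = y"
    using y assms(2) by (simp add: \<mu>_def powr_powr flip: powr_realpow)
  then have "(\<mu> ^ r)\<^sup>2 = \<mu> ^ r + of_nat d * 2 ^ (r - 1)"
    using yy by simp
  then have "(complex_of_real \<mu> ^ r)\<^sup>2 = complex_of_real \<mu> ^ r + of_nat d * 2 ^ (r - 1)"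
    by (metis (mono_tags, lifting) of_real_add of_real_mult of_real_numeral of_real_of_nat_eq of_real_power)
  then have "tensor_eigenvalue r n (adjacency_tensor r H) ((complex_of_real \<mu>)\<^sup>2)"
    using \<mu> by (intro eigenvalue_H) auto
  \<comment> \<open>The same eigenvalue serves as the existence witness and as the one being
    bounded. Its modulus is \<open>\<mu>^2\<close>, and no maximality of it is required for a lower
    bound.\<close>
  note spectral_radius_attained(2)[OF this this]
  then have "\<mu>\<^sup>2 \<le> hypergraph_spectral_radius r n H"
    by (simp add: hypergraph_spectral_radius_def norm_power)
  \<comment> \<open>Membership of \<open>H\<close> in the family uses \<open>t \<ge> 3\<close>,
    which follows from \<open>t > r \<ge> 2\<close>.\<close>
  also have "\<dots> \<le> spex_lin r n (complete_bipartite 3 t)"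
    using assms by (intro hypergraph_spectral_radius_le_spex_lin H_in_family) simp
  finally have "\<mu>\<^sup>2 \<le> spex_lin r n (complete_bipartite 3 t)" .
  moreover have "\<mu>\<^sup>2 = 2 powr (- 2 / real r) * (sqrt D + 1) powr (2 / real r)"
  proof -
    have "\<mu>\<^sup>2 = y powr (2 / real r)"
      using y by (simp add: \<mu>_def powr_powr flip: powr_realpow)
    also have "\<dots> = 2 powr (- 2 / real r) * (sqrt D + 1) powr (2 / real r)"
      using D by (simp add: y_def powr_divide powr_minus divide_simps)
    finally show ?thesis .
  qed
  ultimately show ?thesis
    unfolding d D_def by simp
qed

end
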